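(* (a) (mod-BPDN) Let $L(b)=\gamma\|b_{T^c}\|_1+\tfrac12\|y-Ab\|_2^2$. For $0\le k\le|\Delta|$ let $$\tilde\Delta^{**}(k)=\arg\min_{\tilde\Delta\subseteq\Delta,\ |\tilde\Delta|=k}\|x_{\Delta\setminus\tilde\Delta}\|_2,$$ and let $B_k=g_T(\tilde\Delta^{**}(k))$ if $\tilde\Delta^{**}(k)\in\mathcal{G}_T$ and $B_k=\infty$ otherwise. Let $k_{\min}=\arg\min_{0\le k\le|\Delta|}B_k$ and $\tilde\Delta^{**}=\tilde\Delta^{**}(k_{\min})$. If $\gamma=\gamma^*_{T}(\tilde\Delta^{**})$, then $L$ has a unique minimizer $\hat x$ over $\mathbb{R}^m$, $\hat x$ is supported on $T\cup\tilde\Delta^{**}$, and $\|x-\hat x\|_2\le g_T(\tilde\Delta^{**})$. (b) (BPDN) The statement of (a) holds with $T=\emptyset$ and $\Delta=N$, so that $L(b)=\gamma\|b\|_1+\tfrac12\|y-Ab\|_2^2$.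
   Context: Let $n<m$ be positive integers, $A\in\mathbb{R}^{n\times m}$, $x\in\mathbb{R}^m$ with support $N=\{i:x_i\ne0\}$, $w\in\mathbb{R}^n$ and $y=Ax+w$. Let $T\subseteq\{1,\dots,m\}$ and $\Delta=N\setminus T$. Let $\gamma$ be real. Notation: $'$ is transpose; $b_S$ is the subvector of $b$ indexed by $S$; $A_S$ is the submatrix of columns of $A$ indexed by $S$, $A_\omega$ a single column; $S^c$ is the complement in $\{1,\dots,m\}$; $\|\cdot\|_2$ of a matrix is the spectral (operator) norm. A vector is "supported on" a set if its nonzero entries all have indices in that set. Maxima over empty sets and norms of empty vectors or matrices are $0$; an empty matrix counts as invertible. For $S\subseteq\Delta$ define $$Q_{T}(S)={A_{T\cup S}}'A_{T\cup S},\quad M_{T}=I-A_T({A_T}'A_T)^{-1}{A_T}'\ (M_\emptyset=I),\quad P_{T}(S)=({A_S}'M_{T}A_S)^{-1},$$ $$ERC_{T}(S)=1-\max_{\omega\notin T\cup S}\|P_{T}(S){A_S}'M_{T}A_\omega\|_1 .$$ The inverses exist when $Q_{T}(S)$ is invertible. When $Q_{T}(S)$ is invertible, $c_{T}(S)$ denotes the unique minimizer of $\tfrac12\|y-Ab\|_2^2$ over $b\in\mathbb{R}^m$ with $b_{(T\cup S)^c}=0$, and, if also $ERC_T(S)>0$, $$\gamma^*_{T}(S)=\frac{\|{A_{(T\cup S)^c}}'(y-A\,c_{T}(S))\|_\infty}{ERC_{T}(S)} .$$ Further, $$f_1(S)=\sqrt{\|({A_T}'A_T)^{-1}{A_T}'A_SP_{T}(S)\|_2^2+\|P_{T}(S)\|_2^2},\quad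 f_3(S)=\|Q_{T}(S)^{-1}{A_{T\cup S}}'\|_2,$$ $$f_4(S)=\sqrt{\|Q_{T}(S)^{-1}{A_{T\cup S}}'A_{\Delta\setminus S}\|_2^2+1},\quad \mathrm{maxcor}(S)=\max_{i\in(T\cup S)^c}\|{A_i}'A_{T\cup\Delta}\|_2,$$ $$\mathcal{G}_T=\{S\subseteq\Delta:\ Q_{T}(S)\text{ is invertible and }ERC_{T}(S)>0\},$$ and for $S\in\mathcal{G}_T$ $$g_T(S)=g_2\|w\|_2+g_3\|x_{\Delta\setminus S}\|_2+g_4,\qquad g_2=\tfrac{\sqrt{|S|}f_1(S)f_3(S)\,\mathrm{maxcor}(S)}{ERC_{T}(S)}+f_3(S),$$ $$g_3=\tfrac{\sqrt{|S|}f_1(S)f_4(S)\,\mathrm{maxcor}(S)}{ERC_{T}(S)}+f_4(S),\qquad g_4=\tfrac{\sqrt{|S|}\,\|{A_{(T\cup S)^c}}'w\|_\infty f_1(S)}{ERC_{T}(S)} .$$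
   Formalization: Uniqueness of the minimizer is claimed only for γ ≠ 0: if γ* = 0 (e.g. x = 0, w = 0, T = ∅), L is plain least squares and, as n < m, never has a unique minimizer; existence, support and the error bound are still proved for γ = 0. *)

theory Defs
  imports "HOL-Analysis.Analysis"
begin

(* Encoding of subvectors and submatrices: an index set is a subset of the index type, and
   b_S, A_S and matrices indexed by S x S are kept at full size with all entries outside S
   set to 0.  Products, transposes, l1, l2, maximum and operator norms agree with those of
   the genuine subvectors and submatrices, and the norm of an empty object is 0. *)

definition supp :: "real^'m \<Rightarrow> 'm set" where
  "supp b = {i. b $ i \<noteq> 0}"

definition subvec :: "real^'m \<Rightarrow> 'm set \<Rightarrow> real^'m" where
  "subvec b S = (\<chi> i. if i \<in> S then b $ i else 0)"

definition cols :: "real^'m^'n \<Rightarrow> 'm set \<Rightarrow> real^'m^'n" where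
  "cols A S = (\<chi> i j. if j \<in> S then A $ i $ j else 0)"

definition l1norm :: "real^'m \<Rightarrow> real" where
  "l1norm b = (\<Sum>i\<in>UNIV. \<bar>b $ i\<bar>)"

definition opnorm :: "real^'m^'n \<Rightarrow> real" where
  "opnorm B = onorm (\<lambda>v. B *v v)"

definition max0 :: "('i \<Rightarrow> real) \<Rightarrow> 'i set \<Rightarrow> real" where
  "max0 f I = (if I = {} then 0 else Max (f ` I))"

definition id_on :: "'m set \<Rightarrow> real^'m^'m" where
  "id_on S = (\<chi> i j. if i = j \<and> i \<in> S then 1 else 0)"

(* C is the inverse of the S x S matrix B; for S = {} this holds with B = C = 0. *)

definition is_inverse_on :: "'m set \<Rightarrow> real^'m^'m \<Rightarrow> real^'m^'m \<Rightarrow> bool" where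
  "is_inverse_on S B C \<longleftrightarrow>
     (\<forall>i j. i \<notin> S \<or> j \<notin> S \<longrightarrow> C $ i $ j = 0) \<and> B ** C = id_on S \<and> C ** B = id_on S"

definition invertible_on :: "'m set \<Rightarrow> real^'m^'m \<Rightarrow> bool" where
  "invertible_on S B \<longleftrightarrow> (\<exists>C. is_inverse_on S B C)"

definition inv_on :: "'m set \<Rightarrow> real^'m^'m \<Rightarrow> real^'m^'m" where
  "inv_on S B = (THE C. is_inverse_on S B C)"

definition Q :: "real^'m^'n \<Rightarrow> 'm set \<Rightarrow> 'm set \<Rightarrow> real^'m^'m" where
  "Q A T S = transpose (cols A (T \<union> S)) ** cols A (T \<union> S)"

definition Qinv :: "real^'m^'n \<Rightarrow> 'm set \<Rightarrow> 'm set \<Rightarrow> real^'m^'m" where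
  "Qinv A T S = inv_on (T \<union> S) (Q A T S)"

definition gram_inv :: "real^'m^'n \<Rightarrow> 'm set \<Rightarrow> real^'m^'m" where
  "gram_inv A T = inv_on T (transpose (cols A T) ** cols A T)"

definition M :: "real^'m^'n \<Rightarrow> 'm set \<Rightarrow> real^'n^'n" where
  "M A T = mat 1 - cols A T ** gram_inv A T ** transpose (cols A T)"

definition P :: "real^'m^'n \<Rightarrow> 'm set \<Rightarrow> 'm set \<Rightarrow> real^'m^'m" where
  "P A T S = inv_on S (transpose (cols A S) ** M A T ** cols A S)"

definition ERC :: "real^'m^'n \<Rightarrow> 'm set \<Rightarrow> 'm set \<Rightarrow> real" where
  "ERC A T S =
     1 - max0 (\<lambda>\<omega>. l1norm ((P A T S ** transpose (cols A S) ** M A T) *v column \<omega> A)) (- (T \<union> S))"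

definition c :: "real^'m^'n \<Rightarrow> real^'n \<Rightarrow> 'm set \<Rightarrow> 'm set \<Rightarrow> real^'m" where
  "c A y T S =
     (THE b. is_arg_min (\<lambda>b. 1/2 * (norm (y - A *v b))\<^sup>2) (\<lambda>b. subvec b (- (T \<union> S)) = 0) b)"

(* None where the quantity is undefined. *)

definition gamma_star ::
    "real^'m^'n \<Rightarrow> real^'n \<Rightarrow> 'm set \<Rightarrow> 'm set \<Rightarrow> real option" where
  "gamma_star A y T S =
     (if invertible_on (T \<union> S) (Q A T S) \<and> ERC A T S > 0
      then Some (infnorm (transpose (cols A (- (T \<union> S))) *v (y - A *v c A y T S)) / ERC A T S)
      else None)"

definition f1 :: "real^'m^'n \<Rightarrow> 'm set \<Rightarrow> 'm set \<Rightarrow> real" where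
  "f1 A T S =
     sqrt ((opnorm (gram_inv A T ** transpose (cols A T) ** cols A S ** P A T S))\<^sup>2
           + (opnorm (P A T S))\<^sup>2)"

definition f3 :: "real^'m^'n \<Rightarrow> 'm set \<Rightarrow> 'm set \<Rightarrow> real" where
  "f3 A T S = opnorm (Qinv A T S ** transpose (cols A (T \<union> S)))"

definition f4 :: "real^'m^'n \<Rightarrow> 'm set \<Rightarrow> 'm set \<Rightarrow> 'm set \<Rightarrow> real" where
  "f4 A T \<Delta> S =
     sqrt ((opnorm (Qinv A T S ** transpose (cols A (T \<union> S)) ** cols A (\<Delta> - S)))\<^sup>2 + 1)"

definition maxcor :: "real^'m^'n \<Rightarrow> 'm set \<Rightarrow> 'm set \<Rightarrow> 'm set \<Rightarrow> real" where
  "maxcor A T \<Delta> S =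
     max0 (\<lambda>i. norm (transpose (cols A (T \<union> \<Delta>)) *v column i A)) (- (T \<union> S))"

definition G :: "real^'m^'n \<Rightarrow> 'm set \<Rightarrow> 'm set \<Rightarrow> 'm set set" where
  "G A T \<Delta> = {S. S \<subseteq> \<Delta> \<and> invertible_on (T \<union> S) (Q A T S) \<and> ERC A T S > 0}"

definition g2 :: "real^'m^'n \<Rightarrow> 'm set \<Rightarrow> 'm set \<Rightarrow> 'm set \<Rightarrow> real" where
  "g2 A T \<Delta> S =
     sqrt (real (card S)) * f1 A T S * f3 A T S * maxcor A T \<Delta> S / ERC A T S + f3 A T S"

definition g3 :: "real^'m^'n \<Rightarrow> 'm set \<Rightarrow> 'm set \<Rightarrow> 'm set \<Rightarrow> real" where
  "g3 A T \<Delta> S =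
     sqrt (real (card S)) * f1 A T S * f4 A T \<Delta> S * maxcor A T \<Delta> S / ERC A T S + f4 A T \<Delta> S"

definition g4 :: "real^'m^'n \<Rightarrow> real^'n \<Rightarrow> 'm set \<Rightarrow> 'm set \<Rightarrow> real" where
  "g4 A w T S =
     sqrt (real (card S)) * infnorm (transpose (cols A (- (T \<union> S))) *v w) * f1 A T S / ERC A T S"

definition g ::
    "real^'m^'n \<Rightarrow> real^'m \<Rightarrow> real^'n \<Rightarrow> 'm set \<Rightarrow> 'm set \<Rightarrow> 'm set \<Rightarrow> real" where
  "g A x w T \<Delta> S = g2 A T \<Delta> S * norm w + g3 A T \<Delta> S * norm (subvec x (\<Delta> - S)) + g4 A w T S"

definition B ::
    "real^'m^'n \<Rightarrow> real^'m \<Rightarrow> real^'n \<Rightarrow> 'm set \<Rightarrow> 'm set \<Rightarrow> 'm set \<Rightarrow> ereal" where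
  "B A x w T \<Delta> S = (if S \<in> G A T \<Delta> then ereal (g A x w T \<Delta> S) else \<infinity>)"

(* Neither arg min need be unique: S is admissible if it results from some choice D k of a
   minimizing set for every size k and some choice of a minimizing size kmin. *)

definition best_of_size :: "real^'m \<Rightarrow> 'm set \<Rightarrow> nat \<Rightarrow> 'm set \<Rightarrow> bool" where
  "best_of_size x \<Delta> k S \<longleftrightarrow>
     is_arg_min (\<lambda>S. norm (subvec x (\<Delta> - S))) (\<lambda>S. S \<subseteq> \<Delta> \<and> card S = k) S"

definition optimal_subset ::
    "real^'m^'n \<Rightarrow> real^'m \<Rightarrow> real^'n \<Rightarrow> 'm set \<Rightarrow> 'm set \<Rightarrow> 'm set \<Rightarrow> bool" where
  "optimal_subset A x w T \<Delta> S \<longleftrightarrow>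
     (\<exists>D kmin. (\<forall>k \<le> card \<Delta>. best_of_size x \<Delta> k (D k)) \<and>
        is_arg_min (\<lambda>k. B A x w T \<Delta> (D k)) (\<lambda>k. k \<le> card \<Delta>) kmin \<and> S = D kmin)"

definition modBPDN :: "real^'m^'n \<Rightarrow> real^'n \<Rightarrow> real \<Rightarrow> 'm set \<Rightarrow> real^'m \<Rightarrow> real" where
  "modBPDN A y \<gamma> T b = \<gamma> * l1norm (subvec b (- T)) + 1/2 * (norm (y - A *v b))\<^sup>2"

definition BPDN :: "real^'m^'n \<Rightarrow> real^'n \<Rightarrow> real \<Rightarrow> real^'m \<Rightarrow> real" where
  "BPDN A y \<gamma> b = \<gamma> * l1norm b + 1/2 * (norm (y - A *v b))\<^sup>2"

abbreviation minimizer :: "('a \<Rightarrow> real) \<Rightarrow> 'a \<Rightarrow> bool" where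
  "minimizer L b \<equiv> is_arg_min L (\<lambda>_. True) b"

(* gamma_star can be 0, for instance when x = 0 and w = 0.  For \<gamma> = 0 the objective is
   the plain least-squares functional, whose minimizer is never unique if n < m. *)

lemma minimizer_not_unique_at_0:
  fixes A :: "real^'m^'n"
  assumes "CARD('n) < CARD('m)"
  shows "\<not> (\<exists>!b. minimizer (modBPDN A y 0 T) b)"
proof
  assume "\<exists>!b. minimizer (modBPDN A y 0 T) b"
  then obtain b where b: "minimizer (modBPDN A y 0 T) b"
    and uniq: "\<And>b'. minimizer (modBPDN A y 0 T) b' \<Longrightarrow> b' = b" by auto
  have "\<not> inj ((*v) A)"
  proof
    assume "inj ((*v) A)"
    then have "dim (range ((*v) A)) = dim (UNIV :: (real^'m) set)"
      by (intro dim_image_eq) auto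
    moreover have "dim (range ((*v) A)) \<le> dim (UNIV :: (real^'n) set)"
      by (rule dim_subset) simp
    ultimately show False using assms by simp
  qed
  then obtain u v where "u \<noteq> v" "A *v u = A *v v" unfolding inj_def by auto
  then have "A *v (u - v) = 0" "u - v \<noteq> 0" by (auto simp: matrix_vector_mult_diff_distrib)
  moreover from this(1) have "minimizer (modBPDN A y 0 T) (b + (u - v))"
    using b by (simp add: is_arg_min_def modBPDN_def matrix_vector_right_distrib)
  ultimately show False using uniq by fastforce
qed

lemma gamma_star_eq_0: "gamma_star (A :: real^'m^'n) 0 {} {} = Some 0"
proof -
  have cols0: "cols A {} = 0" by (simp add: cols_def vec_eq_iff)
  have Q: "invertible_on {} (Q A {} {})"
    unfolding invertible_on_def is_inverse_on_def Q_def
    by (rule exI[of _ 0]) (simp add: cols0 id_on_def vec_eq_iff matrix_matrix_mult_def)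
  have "transpose (0 :: real^'m^'n) = 0" by (simp add: transpose_def vec_eq_iff)
  then have "P A {} {} ** transpose (cols A {}) ** M A {} = 0"
    by (simp add: cols0 vec_eq_iff matrix_matrix_mult_def)
  then have "ERC A {} {} = 1" by (simp add: ERC_def l1norm_def max0_def)
  moreover have "c A 0 {} {} = 0"
    unfolding c_def
    by (rule the_equality) (auto simp: is_arg_min_def subvec_def vec_eq_iff)
  ultimately show ?thesis using Q by (simp add: gamma_star_def infnorm_0)
qed

end

theory Submission
  imports Defs
begin

text \<open>The minimizer $b$ of $L$ among the vectors supported on $T \cup S$ differs from the
  least-squares solution $c = c_T(S)$ by $\gamma\, Q_T(S)^{-1} s$, where $s$ is supported on $S$ with
  entries in $[-1, 1]$. For $\omega \notin T \cup S$ the correlation of $A_\omega$ with $y - A b$ is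
  that with $y - A c$, at most $\gamma\,ERC_T(S)$ by the choice of $\gamma$, plus a term of size at
  most $\gamma\,(1 - ERC_T(S))$. So it is at most $\gamma$, and $b$ minimizes $L$ globally. The bound
  on $x - b$ splits it as $(x - c) + (c - b)$, and $\gamma$ itself is estimated through
  $y - A c = w + A (x - c)$.\<close>

text \<open>As a simp rule this would turn \<open>transpose A *v r\<close> into
  \<open>r v* A\<close> and hide the adjoint form used throughout.\<close>

declare transpose_matrix_vector [simp del]

section \<open>Subvectors, column submatrices and their norms\<close>

lemma subvec_nth [simp]: "subvec v S $ i = (if i \<in> S then v $ i else 0)"
  by (simp add: subvec_def)

lemma subvec_subvec [simp]: "subvec (subvec v S) R = subvec v (S \<inter> R)"
  by (auto simp: vec_eq_iff)

lemma subvec_UNIV [simp]: "subvec v UNIV = v"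
  by (simp add: vec_eq_iff)

lemma subvec_add: "subvec (u + v) S = subvec u S + subvec v S"
  and subvec_diff: "subvec (u - v) S = subvec u S - subvec v S"
  and subvec_scaleR: "subvec (r *\<^sub>R v) S = r *\<^sub>R subvec v S"
  by (auto simp: vec_eq_iff)

lemma subvec_0 [simp]: "subvec 0 S = 0"
  by (simp add: vec_eq_iff)

lemma linear_subvec: "linear (\<lambda>v. subvec v S)"
  by (rule linearI) (auto simp: subvec_add subvec_scaleR)

lemma subvec_id_iff: "subvec v S = v \<longleftrightarrow> (\<forall>i. i \<notin> S \<longrightarrow> v $ i = 0)"
  by (auto simp: vec_eq_iff)

lemma subvec_compl_eq_0_iff: "subvec v (- S) = 0 \<longleftrightarrow> subvec v S = v"
  by (auto simp: vec_eq_iff)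

lemma inner_subvec: "subvec u S \<bullet> v = u \<bullet> subvec v S"
  by (auto simp: inner_vec_def intro: sum.cong)

text \<open>Pythagoras for disjoint supports; the source of the square roots in \<open>f1\<close>
  and \<open>f4\<close>.\<close>

lemma norm_add_disjoint:
  assumes "subvec u S = u" "subvec v R = v" "S \<inter> R = {}"
  shows "(norm (u + v))\<^sup>2 = (norm u)\<^sup>2 + (norm v)\<^sup>2"
proof -
  have "u \<bullet> v = u \<bullet> subvec v (R \<inter> S)"
    using inner_subvec[of u S v] assms(1,2) subvec_subvec[of v R S] by simp
  also have "R \<inter> S = {}" using assms(3) by auto
  finally have "u \<bullet> v = 0" by (simp add: inner_vec_def)
  then show ?thesis by (simp add: power2_norm_eq_inner inner_add inner_commute)
qed

text \<open>Together with \<open>transpose_cols_mult\<close>, this moves the index set from the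
  matrix to the vector, so that later arguments deal only with \<open>A\<close>,
  \<open>transpose A\<close> and \<open>subvec\<close>.\<close>

lemma cols_mult: "cols A S *v v = A *v subvec v S"
  by (auto simp: vec_eq_iff matrix_vector_mult_def cols_def intro!: sum.cong)

lemma transpose_cols_mult: "transpose (cols A S) *v r = subvec (transpose A *v r) S"
  by (auto simp: vec_eq_iff matrix_vector_mult_def cols_def transpose_def)

lemma id_on_mult: "id_on S *v v = subvec v S"
  by (auto simp: vec_eq_iff matrix_vector_mult_def id_on_def if_distrib if_distribR
      sum.delta cong: if_cong)

lemma transpose_mult_nth: "(transpose A *v r) $ i = column i A \<bullet> r"
  by (simp add: matrix_vector_mult_def transpose_def column_def inner_vec_def)

lemma inner_matrix_mult: "((A::real^'m^'n) *v b) \<bullet> r = b \<bullet> (transpose A *v r)"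
  by (metis dot_lmul_matrix inner_commute transpose_matrix_vector transpose_transpose)

lemma opnorm_bound: "norm ((A::real^'m^'n) *v v) \<le> opnorm A * norm v"
  unfolding opnorm_def by (rule onorm) (simp add: linear_conv_bounded_linear[symmetric])

lemma opnorm_nonneg: "0 \<le> opnorm (A::real^'m^'n)"
  unfolding opnorm_def by (rule onorm_pos_le) (simp add: linear_conv_bounded_linear[symmetric])

section \<open>Inverses relative to an index set\<close>

text \<open>Since \<open>C\<close> vanishes outside its \<open>S\<close>-by-\<open>S\<close> block,
  \<open>id_on S\<close> acts on it as a unit from both sides. This makes the relative inverse
  unique.\<close>

lemma is_inverse_on_supp:
  assumes "is_inverse_on S H C"
  shows "id_on S ** C = C" "C ** id_on S = C"
proof -
  have z: "\<And>i j. i \<notin> S \<or> j \<notin> S \<Longrightarrow> C $ i $ j = 0"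
    using assms by (auto simp: is_inverse_on_def)
  have "subvec (C *v v) S = C *v v" for v
    using z by (simp add: subvec_id_iff matrix_vector_mult_def)
  moreover have "C *v subvec v S = C *v v" for v
    using z by (auto simp: vec_eq_iff matrix_vector_mult_def intro!: sum.cong)
  ultimately show "id_on S ** C = C" "C ** id_on S = C"
    by (simp_all add: matrix_eq matrix_vector_mul_assoc[symmetric] id_on_mult)
qed

lemma is_inverse_on_unique:
  assumes "is_inverse_on S H C" "is_inverse_on S H D"
  shows "C = D"
proof -
  have "C = C ** (H ** D)"
    using assms(2) is_inverse_on_supp(2)[OF assms(1)] by (simp add: is_inverse_on_def)
  also have "\<dots> = id_on S ** D"
    using assms(1) by (simp add: is_inverse_on_def matrix_mul_assoc)
  finally show ?thesis using is_inverse_on_supp(1)[OF assms(2)] by simp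
qed

lemma is_inverse_on_inv_on:
  assumes "invertible_on S H"
  shows "is_inverse_on S H (inv_on S H)"
proof -
  from assms obtain C where "is_inverse_on S H C" by (auto simp: invertible_on_def)
  then have "inv_on S H = C"
    unfolding inv_on_def by (intro the_equality) (auto intro: is_inverse_on_unique)
  then show ?thesis using \<open>is_inverse_on S H C\<close> by simp
qed

lemma is_inverse_on_mult:
  assumes "is_inverse_on S H C"
  shows "subvec (C *v v) S = C *v v" "C *v subvec v S = C *v v"
    "H *v (C *v v) = subvec v S" "C *v (H *v v) = subvec v S"
  using assms is_inverse_on_supp[OF assms]
  by (simp_all add: id_on_mult[symmetric] matrix_vector_mul_assoc is_inverse_on_def)

lemma transpose_id_on: "transpose (id_on S) = id_on S"
  by (auto simp: transpose_def id_on_def vec_eq_iff)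

text \<open>Transposing the two inverse identities gives them again for \<open>transpose C\<close>,
  and uniqueness applies. Used for the symmetry of \<open>gram_inv\<close> and
  \<open>P\<close>.\<close>

lemma is_inverse_on_transpose:
  assumes "is_inverse_on S H C" "transpose H = H"
  shows "transpose C = C"
proof (rule is_inverse_on_unique)
  have "transpose C ** H = transpose (H ** C)" "H ** transpose C = transpose (C ** H)"
    using assms(2) by (simp_all add: matrix_transpose_mul)
  then show "is_inverse_on S H (transpose C)"
    using assms(1) by (auto simp: is_inverse_on_def transpose_id_on) (auto simp: transpose_def)
qed (rule assms(1))

text \<open>Adding the identity on the complement gives an injective, hence invertible, square
  matrix; its inverse restricted to \<open>S\<close> is the relative inverse of
  \<open>H\<close>.\<close>

lemma invertible_onI:
  fixes H :: "real^'m^'m"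
  assumes l: "id_on S ** H = H" and r: "H ** id_on S = H"
    and inj: "\<And>v. subvec v S = v \<Longrightarrow> H *v v = 0 \<Longrightarrow> v = 0"
  shows "invertible_on S H"
proof -
  define E where "E = H + id_on (- S)"
  have E: "E *v v = H *v v + subvec v (- S)" for v
    by (simp add: E_def matrix_vector_mult_add_rdistrib id_on_mult)
  have BS: "H *v subvec v S = H *v v" "subvec (H *v v) S = H *v v" for v
    using l r by (simp_all add: id_on_mult[symmetric] matrix_vector_mul_assoc)
  have "v = 0" if "E *v v = 0" for v
  proof -
    \<comment> \<open>Outside \<open>S\<close> only the added identity contributes, so a kernel
      vector of \<open>E\<close> is supported on \<open>S\<close>.\<close>
    have "subvec (E *v v) (- S) = subvec v (- S)"
      using subvec_subvec[of "H *v v" S "- S"] BS(2)[of v]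
      by (simp add: E subvec_add vec_eq_iff)
    then have v: "subvec v (- S) = 0" using that by simp
    then have "H *v v = 0" using that E[of v] by simp
    then show ?thesis using inj[of v] v by (simp add: subvec_compl_eq_0_iff)
  qed
  then obtain D where DE: "D ** E = mat 1"
    using matrix_left_invertible_ker[of E] by auto
  then have ED: "E ** D = mat 1" by (simp add: matrix_left_right_inverse)
  have SE: "id_on S ** E = H" "E ** id_on S = H"
  proof -
    have "(id_on S ** E) *v v = H *v v" "(E ** id_on S) *v v = H *v v" for v
      using BS by (simp_all add: matrix_vector_mul_assoc[symmetric] id_on_mult E subvec_add)
        (simp_all add: vec_eq_iff)
    then show "id_on S ** E = H" "E ** id_on S = H" by (simp_all add: matrix_eq)
  qed
  \<comment> \<open>By \<open>SE\<close>, \<open>id_on S\<close> commutes with \<open>E\<close>,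
    hence with its inverse \<open>D\<close>.\<close>
  have DS: "D ** id_on S = id_on S ** D"
  proof -
    have "D ** id_on S = D ** (id_on S ** (E ** D))" by (simp add: ED)
    also have "\<dots> = D ** (E ** id_on S) ** D" by (simp add: SE matrix_mul_assoc)
    also have "\<dots> = id_on S ** D" by (simp add: matrix_mul_assoc DE)
    finally show ?thesis .
  qed
  have "H ** (D ** id_on S) = id_on S"
    by (metis ED SE(1) matrix_mul_assoc matrix_mul_rid DS r SE(2))
  moreover have "(D ** id_on S) ** H = id_on S"
    by (metis DE SE(2) DS l matrix_mul_assoc matrix_mul_lid)
  moreover have "(D ** id_on S) $ i $ j = 0" if "i \<notin> S \<or> j \<notin> S" for i j
  proof (cases "j \<in> S")
    case True
    then show ?thesis using that
      unfolding DS by (simp add: matrix_matrix_mult_def id_on_def)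
  next
    case False
    then show ?thesis by (auto simp add: matrix_matrix_mult_def id_on_def intro!: sum.neutral)
  qed
  ultimately show ?thesis by (auto simp: invertible_on_def is_inverse_on_def)
qed


section \<open>Optimality conditions for the objective\<close>

text \<open>Divide by \<open>t\<close> and let it tend to 0. This replaces subdifferential calculus
  in the first-order conditions below.\<close>

lemma linear_term_nonpos:
  fixes a k :: real
  assumes "\<And>t. 0 < t \<Longrightarrow> t < 1 \<Longrightarrow> t * a \<le> t\<^sup>2 * k"
  shows "a \<le> 0"
proof (rule field_le_epsilon)
  fix e :: real assume "0 < e"
  \<comment> \<open>The cap \<open>1/2\<close> keeps \<open>t\<close> below 1; adding 1 keeps the
    denominator positive, and the quotient makes \<open>t * k\<close> at most
    \<open>e\<close>.\<close>
  define t where "t = min (1/2) (e / (\<bar>k\<bar> + 1))"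
  have t: "0 < t" "t < 1" "t \<le> e / (\<bar>k\<bar> + 1)" using \<open>0 < e\<close> by (auto simp: t_def)
  then have "a \<le> t * k" using assms[of t] by (simp add: power2_eq_square)
  also have "\<dots> \<le> t * (\<bar>k\<bar> + 1)" using t by (intro mult_left_mono) auto
  also have "\<dots> \<le> e" using t(3) by (simp add: field_simps)
  finally show "a \<le> 0 + e" by simp
qed

lemma l1norm_nonneg: "0 \<le> l1norm v"
  by (simp add: l1norm_def sum_nonneg)

lemma l1norm_scaleR: "l1norm (r *\<^sub>R v) = \<bar>r\<bar> * l1norm v"
  by (simp add: l1norm_def abs_mult sum_distrib_left)

lemma l1norm_triangle: "l1norm (u + v) \<le> l1norm u + l1norm v"
  unfolding l1norm_def sum.distrib[symmetric] by (intro sum_mono) simp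

lemma l1norm_axis: "l1norm (axis i r) = \<bar>r\<bar>"
  by (simp add: l1norm_def axis_def if_distrib cong: if_cong)

lemma subvec_axis: "subvec (axis i r) S = (if i \<in> S then axis i r else 0)"
  by (auto simp: vec_eq_iff axis_def)

lemma l1norm_0 [simp]: "l1norm 0 = 0"
  by (simp add: l1norm_def)

lemma continuous_on_modBPDN: "continuous_on X (modBPDN A y \<gamma> T)"
proof -
  have "continuous_on X (\<lambda>b. subvec b S)" for S
    by (intro linear_continuous_on linear_subvec[unfolded linear_conv_bounded_linear])
  then show ?thesis
    unfolding modBPDN_def l1norm_def matrix_vector_mult_def by (intro continuous_intros)
qed

text \<open>Only the quadratic part is expanded, and exactly so; its linear coefficient is the
  correlation of the residual with the columns.\<close>

lemma modBPDN_add: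
  "modBPDN A y \<gamma> T (b + h) = \<gamma> * l1norm (subvec (b + h) (- T)) + 1/2 * (norm (y - A *v b))\<^sup>2
     - h \<bullet> (transpose A *v (y - A *v b)) + 1/2 * (norm (A *v h))\<^sup>2"
proof -
  have "y - A *v (b + h) = (y - A *v b) - A *v h"
    by (simp add: matrix_vector_right_distrib)
  then show ?thesis
    using dot_norm_neg[of "y - A *v b" "A *v h"]
    by (simp add: modBPDN_def inner_matrix_mult[symmetric] inner_commute field_simps)
qed

text \<open>\<open>D\<close> bounds the slope of the l1 part along \<open>h\<close>. Comparing
  \<open>b\<close> with a small shift along \<open>h\<close> leaves the linear terms, since the
  quadratic one is of order \<open>t\<^sup>2\<close>.\<close>

lemma directional_derivative_bound:
  assumes min: "\<And>t. 0 < t \<Longrightarrow> t < 1 \<Longrightarrow> modBPDN A y \<gamma> T b \<le> modBPDN A y \<gamma> T (b + t *\<^sub>R h)"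
    and l1: "\<And>t. 0 < t \<Longrightarrow> t < 1 \<Longrightarrow>
      \<gamma> * l1norm (subvec (b + t *\<^sub>R h) (- T)) \<le> \<gamma> * (l1norm (subvec b (- T)) + t * D)"
  shows "h \<bullet> (transpose A *v (y - A *v b)) \<le> \<gamma> * D"
proof -
  have "h \<bullet> (transpose A *v (y - A *v b)) - \<gamma> * D \<le> 0"
  proof (rule linear_term_nonpos)
    fix t :: real assume t: "0 < t" "t < 1"
    have "(norm (A *v (t *\<^sub>R h)))\<^sup>2 = t\<^sup>2 * (norm (A *v h))\<^sup>2"
      by (simp add: matrix_vector_mult_scaleR power_mult_distrib)
    then show "t * (h \<bullet> (transpose A *v (y - A *v b)) - \<gamma> * D)
        \<le> t\<^sup>2 * (1/2 * (norm (A *v h))\<^sup>2)"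
      using min[OF t] l1[OF t] unfolding modBPDN_add
      by (simp add: modBPDN_def algebra_simps)
  qed
  then show ?thesis by simp
qed

text \<open>The subgradient condition $q_i b_i = \gamma |b_i|$ enters summed over $i \notin T$.\<close>

lemma modBPDN_minimizer:
  fixes A :: "real^'m^'n"
  defines "q b y \<equiv> transpose A *v (y - A *v b)"
  assumes \<gamma>: "\<forall>i. \<bar>q b y $ i\<bar> \<le> \<gamma>" and T: "\<forall>i\<in>T. q b y $ i = 0"
    and sub: "\<gamma> * l1norm (subvec b (- T)) \<le> b \<bullet> q b y"
  shows "minimizer (modBPDN A y \<gamma> T) b"
    and "minimizer (modBPDN A y \<gamma> T) b' \<Longrightarrow> A *v b' = A *v b"
    and "minimizer (modBPDN A y \<gamma> T) b' \<Longrightarrow> i \<notin> T \<Longrightarrow> b' $ i * q b y $ i = \<gamma> * \<bar>b' $ i\<bar>"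
proof -
  define r where "r = q b y"
  \<comment> \<open>The slack in the subgradient inequality at coordinate \<open>i\<close>. It is 0
    on \<open>T\<close>, where \<open>r\<close> vanishes and no penalty acts.\<close>
  define gap where "gap b' i = (if i \<in> T then 0 else \<gamma> * \<bar>b' $ i\<bar> - b' $ i * r $ i)" for b' i
  have le: "b' $ i * r $ i \<le> \<gamma> * \<bar>b' $ i\<bar>" for b' :: "real^'m" and i
  proof -
    have "b' $ i * r $ i \<le> \<bar>b' $ i\<bar> * \<bar>r $ i\<bar>" by (metis abs_ge_self abs_mult)
    also have "\<dots> \<le> \<bar>b' $ i\<bar> * \<gamma>" using \<gamma> by (intro mult_left_mono) (auto simp: r_def)
    finally show ?thesis by (simp add: mult.commute)
  qed
  then have gap_nonneg: "0 \<le> gap b' i" for b' i by (simp add: gap_def)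
  have gap_sum: "\<gamma> * l1norm (subvec b' (- T)) - b' \<bullet> r = sum (gap b') UNIV" for b'
    unfolding l1norm_def inner_vec_def sum_distrib_left sum_subtractf[symmetric]
    using T by (intro sum.cong) (auto simp: gap_def r_def)
  have gap_b: "sum (gap b) UNIV \<le> 0"
    using sub gap_sum[of b] by (simp add: r_def)
  \<comment> \<open>The difference of the objective values is exactly
    \<open>sum (gap b') UNIV - sum (gap b) UNIV\<close> plus the quadratic term, and the subtracted
    sum is at most 0.\<close>
  have excess: "sum (gap b') UNIV + 1/2 * (norm (A *v (b' - b)))\<^sup>2
      \<le> modBPDN A y \<gamma> T b' - modBPDN A y \<gamma> T b" for b'
  proof -
    have "modBPDN A y \<gamma> T b' = \<gamma> * l1norm (subvec b' (- T)) + 1/2 * (norm (y - A *v b))\<^sup>2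
        - (b' \<bullet> r - b \<bullet> r) + 1/2 * (norm (A *v (b' - b)))\<^sup>2"
      using modBPDN_add[of A y \<gamma> T b "b' - b"] by (simp add: r_def q_def inner_diff_left)
    moreover have "modBPDN A y \<gamma> T b = \<gamma> * l1norm (subvec b (- T)) + 1/2 * (norm (y - A *v b))\<^sup>2"
      by (rule modBPDN_def)
    ultimately show ?thesis using gap_sum[of b'] gap_sum[of b] gap_b by linarith
  qed
  have nonneg: "0 \<le> sum (gap b') UNIV" for b' by (simp add: gap_nonneg sum_nonneg)
  have "modBPDN A y \<gamma> T b \<le> modBPDN A y \<gamma> T b'" for b'
    using excess[of b'] nonneg[of b'] zero_le_power2[of "norm (A *v (b' - b))"] by linarith
  then show "minimizer (modBPDN A y \<gamma> T) b" by (auto simp: is_arg_min_def not_less)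
  assume "minimizer (modBPDN A y \<gamma> T) b'"
  then have "modBPDN A y \<gamma> T b' \<le> modBPDN A y \<gamma> T b" by (auto simp: is_arg_min_def not_less)
  \<comment> \<open>For a second minimizer both nonnegative terms on the left of
    \<open>excess\<close> must vanish.\<close>
  then have z: "sum (gap b') UNIV = 0" "(norm (A *v (b' - b)))\<^sup>2 = 0"
    using excess[of b'] nonneg[of b'] zero_le_power2[of "norm (A *v (b' - b))"] by linarith+
  then show "A *v b' = A *v b" by (simp add: matrix_vector_mult_diff_distrib)
  assume "i \<notin> T"
  then show "b' $ i * q b y $ i = \<gamma> * \<bar>b' $ i\<bar>"
    using z(1) gap_nonneg by (auto simp: sum_nonneg_eq_0_iff gap_def r_def split: if_splits)
qed

lemma infnorm_leI:
  assumes "\<And>i. \<bar>(v::real^'m) $ i\<bar> \<le> K"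
  shows "infnorm v \<le> K"
  unfolding infnorm_Max using assms by (auto simp: Basis_vec_def inner_axis)

lemma maxcor_nonneg: "0 \<le> maxcor A T \<Delta> S"
  by (auto simp: maxcor_def max0_def intro!: Max_ge_iff[THEN iffD2])

section \<open>Gram matrix, projection and Schur complement\<close>

text \<open>Invertibility of the Gram matrix means that the columns indexed by
  \<open>T \<union> S\<close> are independent; disjointness allows splitting vectors into blocks on
  \<open>T\<close> and \<open>S\<close>.\<close>

locale independent_columns =
  fixes A :: "real^'m^'n" and T S :: "'m set"
  assumes disjoint: "T \<inter> S = {}" and invertible_Q: "invertible_on (T \<union> S) (Q A T S)"
begin

lemma Qinv: "is_inverse_on (T \<union> S) (Q A T S) (Qinv A T S)"
  unfolding Qinv_def by (rule is_inverse_on_inv_on) (rule invertible_Q)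

lemma Q_mult: "Q A T S *v v = subvec (transpose A *v (A *v subvec v (T \<union> S))) (T \<union> S)"
  by (simp add: Q_def matrix_vector_mul_assoc[symmetric] cols_mult transpose_cols_mult)

text \<open>\<open>Qinv\<close> ignores entries outside \<open>T \<union> S\<close>, so the
  unrestricted transpose may be used: \<open>Qinv A T S ** transpose A\<close> is a left inverse of
  \<open>A\<close> on vectors supported there.\<close>

lemma Qinv_normal_equations:
  assumes "subvec v (T \<union> S) = v"
  shows "Qinv A T S *v (transpose A *v (A *v v)) = v"
  using is_inverse_on_mult(2)[OF Qinv, of "transpose A *v (A *v v)"]
    is_inverse_on_mult(4)[OF Qinv, of v] assms
  by (simp add: Q_mult)

lemma normal_equations_inj:
  assumes "subvec u (T \<union> S) = u" "subvec v (T \<union> S) = v"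
    and "subvec (transpose A *v (A *v u)) (T \<union> S) = subvec (transpose A *v (A *v v)) (T \<union> S)"
  shows "u = v"
  by (metis Qinv_normal_equations assms is_inverse_on_mult(2)[OF Qinv])

lemma columns_inj:
  assumes "subvec v (T \<union> S) = v" "A *v v = 0"
  shows "v = 0"
  using Qinv_normal_equations[OF assms(1)] assms(2) by simp

text \<open>A kernel vector \<open>v\<close> supported on \<open>T\<close> has
  \<open>A *v v = 0\<close>, and independence of the larger set of columns gives
  \<open>v = 0\<close>.\<close>

lemma gram_inv: "is_inverse_on T (transpose (cols A T) ** cols A T) (gram_inv A T)"
  unfolding gram_inv_def
proof (rule is_inverse_on_inv_on, rule invertible_onI)
  let ?H = "transpose (cols A T) ** cols A T"
  have H: "?H *v v = subvec (transpose A *v (A *v subvec v T)) T" for v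
    by (simp add: matrix_vector_mul_assoc[symmetric] cols_mult transpose_cols_mult)
  show "id_on T ** ?H = ?H" "?H ** id_on T = ?H"
    by (simp_all add: matrix_eq matrix_vector_mul_assoc[symmetric] id_on_mult cols_mult
        transpose_cols_mult)
  fix v assume v: "subvec v T = v" and "?H *v v = 0"
  then have "subvec (transpose A *v (A *v v)) T = 0" by (simp add: H)
  then have "subvec v T \<bullet> (transpose A *v (A *v v)) = 0" by (simp add: inner_subvec)
  then have "A *v v = 0" using v by (simp add: inner_matrix_mult[symmetric])
  moreover have "subvec v (T \<union> S) = v" using v by (auto simp: subvec_id_iff)
  ultimately show "v = 0" by (rule columns_inj[rotated])
qed

lemma gram_inv_normal:
  "subvec (transpose A *v (A *v (gram_inv A T *v v))) T = subvec v T"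
  using is_inverse_on_mult(1,3)[OF gram_inv, of v]
  by (simp add: matrix_vector_mul_assoc[symmetric] cols_mult transpose_cols_mult)

lemma transpose_M: "transpose (M A T) = M A T"
proof -
  have "transpose (gram_inv A T) = gram_inv A T"
    by (rule is_inverse_on_transpose[OF gram_inv]) (simp add: matrix_transpose_mul)
  moreover have "transpose (X - Y) = transpose X - transpose Y" for X Y :: "real^'n^'n"
    by (simp add: transpose_def vec_eq_iff)
  ultimately show ?thesis
    by (simp add: M_def matrix_transpose_mul matrix_mul_assoc)
qed

lemma M_mult: "M A T *v r = r - A *v (gram_inv A T *v (transpose A *v r))"
  using is_inverse_on_mult(1,2)[OF gram_inv]
  by (simp add: M_def matrix_vector_mult_diff_rdistrib matrix_vector_mul_assoc[symmetric]
      cols_mult transpose_cols_mult)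

text \<open>\<open>M A T\<close> projects onto the orthogonal complement of the span of the columns
  indexed by \<open>T\<close>.\<close>

lemma M_orthogonal: "subvec (transpose A *v (M A T *v r)) T = 0"
  by (simp add: M_mult matrix_vector_mult_diff_distrib subvec_diff gram_inv_normal)

text \<open>The difference of \<open>r\<close> and its projection lies in the column span of
  \<open>T\<close>, which is orthogonal to the projection.\<close>

lemma M_inner: "r \<bullet> (M A T *v r) = (norm (M A T *v r))\<^sup>2"
proof -
  let ?z = "gram_inv A T *v (transpose A *v r)"
  have "(A *v ?z) \<bullet> (M A T *v r) = subvec ?z T \<bullet> (transpose A *v (M A T *v r))"
    by (simp add: inner_matrix_mult is_inverse_on_mult(1)[OF gram_inv])
  also have "\<dots> = 0" by (simp add: inner_subvec M_orthogonal)
  finally have "(r - M A T *v r) \<bullet> (M A T *v r) = 0" by (simp add: M_mult[of r])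
  then show ?thesis by (simp add: inner_diff_left power2_norm_eq_inner)
qed

text \<open>The inverted matrix is the Schur complement of the \<open>T\<close>-block of the Gram
  matrix. If it annihilates \<open>v\<close>, the projection of \<open>A *v v\<close> is zero, so
  \<open>A *v v\<close> lies in the column span of \<open>T\<close>, contrary to independence unless
  \<open>v = 0\<close>.\<close>

lemma P: "is_inverse_on S (transpose (cols A S) ** M A T ** cols A S) (P A T S)"
  unfolding P_def
proof (rule is_inverse_on_inv_on, rule invertible_onI)
  let ?H = "transpose (cols A S) ** M A T ** cols A S"
  have H: "?H *v v = subvec (transpose A *v (M A T *v (A *v subvec v S))) S" for v
    by (simp add: matrix_vector_mul_assoc[symmetric] cols_mult transpose_cols_mult)
  show "id_on S ** ?H = ?H" "?H ** id_on S = ?H"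
    by (simp_all add: matrix_eq matrix_vector_mul_assoc[symmetric] id_on_mult cols_mult
        transpose_cols_mult)
  fix v assume v: "subvec v S = v" and "?H *v v = 0"
  then have "subvec (transpose A *v (M A T *v (A *v v))) S = 0" by (simp add: H)
  then have "subvec v S \<bullet> (transpose A *v (M A T *v (A *v v))) = 0"
    by (simp add: inner_subvec)
  then have "M A T *v (A *v v) = 0"
    using v by (simp add: inner_matrix_mult[symmetric] M_inner)
  then have "A *v (v - gram_inv A T *v (transpose A *v (A *v v))) = 0" (is "A *v (v - ?z) = 0")
    by (simp add: M_mult matrix_vector_mult_diff_distrib)
  moreover have z: "subvec ?z T = ?z" by (rule is_inverse_on_mult(1)[OF gram_inv])
  then have "subvec (v - ?z) (T \<union> S) = v - ?z" using v by (simp add: subvec_id_iff)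
  ultimately have "v - ?z = 0" by (intro columns_inj)
  \<comment> \<open>\<open>v\<close> is supported on \<open>S\<close> and \<open>?z\<close> on
    \<open>T\<close>, so their equality makes both vanish.\<close>
  then have vz: "v = ?z" by simp
  have "v $ i = 0" for i
  proof (cases "i \<in> S")
    case True
    then have "?z $ i = 0" using z disjoint unfolding subvec_id_iff by auto
    then show ?thesis using vz by metis
  qed (use v subvec_id_iff in auto)
  then show "v = 0" by (simp add: vec_eq_iff)
qed

lemma transpose_P: "transpose (P A T S) = P A T S"
  by (rule is_inverse_on_transpose[OF P])
    (simp add: matrix_transpose_mul transpose_M matrix_mul_assoc)

text \<open>The vector $Q_T(S)^{-1} s$ for $s$ supported on $S$, by block inversion of the Gram matrix.\<close>

definition lift :: "real^'m \<Rightarrow> real^'m" where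
  "lift s = P A T S *v s - gram_inv A T *v (transpose A *v (A *v (P A T S *v s)))"

lemma lift_supp: "subvec (lift s) (T \<union> S) = lift s"
  using is_inverse_on_mult(1)[OF P, of s]
    is_inverse_on_mult(1)[OF gram_inv, of "transpose A *v (A *v (P A T S *v s))"]
  by (simp add: lift_def subvec_id_iff)

text \<open>The subtracted term of \<open>lift s\<close> holds the coefficients of the projection
  onto the column span of \<open>T\<close>, so \<open>A\<close> maps the difference to the
  complementary projection.\<close>

lemma lift_image: "A *v lift s = M A T *v (A *v (P A T S *v s))"
  by (simp add: lift_def M_mult matrix_vector_mult_diff_distrib)

text \<open>The projection kills the entries on \<open>T\<close>; on \<open>S\<close> the Schur
  complement cancels \<open>P\<close>.\<close>

lemma lift_normal: "subvec (transpose A *v (A *v lift s)) (T \<union> S) = subvec s S"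
proof -
  have "subvec (transpose A *v (A *v lift s)) T = 0"
    by (simp add: lift_image M_orthogonal)
  moreover have "subvec (transpose A *v (A *v lift s)) S = subvec s S"
    using is_inverse_on_mult(1,3)[OF P, of s]
    by (simp add: lift_image matrix_vector_mul_assoc[symmetric] cols_mult transpose_cols_mult)
  ultimately show ?thesis using disjoint
    unfolding vec_eq_iff subvec_nth zero_index by (metis Un_iff disjoint_iff)
qed

text \<open>The two terms of \<open>lift s\<close> are supported on \<open>S\<close> and on
  \<open>T\<close>, so their squared norms add, as in \<open>f1\<close>.\<close>

lemma lift_norm: "norm (lift s) \<le> f1 A T S * norm s"
proof (rule power2_le_imp_le)
  let ?u = "P A T S *v s"
  let ?K = "gram_inv A T ** transpose (cols A T) ** cols A S ** P A T S"
  have K: "?K *v s = gram_inv A T *v (transpose A *v (A *v ?u))"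
    using is_inverse_on_mult(1)[OF P] is_inverse_on_mult(2)[OF gram_inv]
    by (simp add: matrix_vector_mul_assoc[symmetric] cols_mult transpose_cols_mult)
  have "(norm (?u + - (?K *v s)))\<^sup>2 = (norm ?u)\<^sup>2 + (norm (- (?K *v s)))\<^sup>2"
  proof (rule norm_add_disjoint)
    show "subvec ?u S = ?u" by (rule is_inverse_on_mult(1)[OF P])
    show "subvec (- (?K *v s)) T = - (?K *v s)"
      using is_inverse_on_mult(1)[OF gram_inv, of "transpose A *v (A *v ?u)"]
      by (simp add: K subvec_id_iff)
    show "S \<inter> T = {}" using disjoint by auto
  qed
  then have "(norm (lift s))\<^sup>2 = (norm ?u)\<^sup>2 + (norm (?K *v s))\<^sup>2"
    by (simp add: lift_def K)
  also have "\<dots> \<le> (opnorm (P A T S) * norm s)\<^sup>2 + (opnorm ?K * norm s)\<^sup>2"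
    by (intro add_mono power_mono opnorm_bound) auto
  also have "\<dots> = (f1 A T S * norm s)\<^sup>2"
    by (simp add: f1_def power_mult_distrib algebra_simps)
  finally show "(norm (lift s))\<^sup>2 \<le> (f1 A T S * norm s)\<^sup>2" .
  show "0 \<le> f1 A T S * norm s" by (simp add: f1_def)
qed

text \<open>By symmetry of \<open>M\<close> and \<open>P\<close> the correlation is the inner
  product of \<open>s\<close> with the vector whose l1 norm enters \<open>ERC\<close>; Hoelder's
  inequality concludes.\<close>

lemma lift_correlation:
  assumes "\<And>i. \<bar>s $ i\<bar> \<le> 1" and "i \<notin> T \<union> S"
  shows "\<bar>column i A \<bullet> (A *v lift s)\<bar> \<le> 1 - ERC A T S"
proof -
  let ?p = "(P A T S ** transpose (cols A S) ** M A T) *v column i A"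
  have "column i A \<bullet> (A *v lift s) = column i A \<bullet> (M A T *v (A *v (P A T S *v s)))"
    by (simp add: lift_image)
  also have "\<dots> = (M A T *v column i A) \<bullet> (A *v (P A T S *v s))"
    by (simp add: inner_matrix_mult transpose_M)
  also have "\<dots> = (transpose A *v (M A T *v column i A)) \<bullet> (P A T S *v s)"
    by (metis inner_commute inner_matrix_mult)
  also have "\<dots> = (P A T S *v (transpose A *v (M A T *v column i A))) \<bullet> s"
    by (simp add: inner_matrix_mult transpose_P)
  also have "\<dots> = ?p \<bullet> s"
    using is_inverse_on_mult(2)[OF P]
    by (simp add: matrix_vector_mul_assoc[symmetric] transpose_cols_mult)
  finally have "\<bar>column i A \<bullet> (A *v lift s)\<bar> = \<bar>\<Sum>j\<in>UNIV. ?p $ j * s $ j\<bar>"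
    by (simp add: inner_vec_def)
  also have "\<dots> \<le> (\<Sum>j\<in>UNIV. \<bar>?p $ j * s $ j\<bar>)" by (rule sum_abs)
  also have "\<dots> \<le> l1norm ?p"
    unfolding l1norm_def by (intro sum_mono) (simp add: abs_mult mult_left_le assms(1))
  also have "\<dots> \<le> 1 - ERC A T S"
    using assms(2) by (auto simp: ERC_def max0_def intro!: Max_ge)
  finally show ?thesis .
qed

section \<open>The least-squares solution and its error\<close>

text \<open>The candidate \<open>d\<close> solves the normal equations, so its residual is
  orthogonal to the columns in \<open>T \<union> S\<close>. Pythagoras makes it a minimizer,
  independence the only one.\<close>

lemma c_eq: "c A y T S = Qinv A T S *v (transpose A *v y)"
  and c_supp: "subvec (c A y T S) (T \<union> S) = c A y T S"
  and c_normal: "subvec (transpose A *v (y - A *v c A y T S)) (T \<union> S) = 0"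
proof -
  define d where "d = Qinv A T S *v (transpose A *v y)"
  have d_supp: "subvec d (T \<union> S) = d"
    unfolding d_def by (rule is_inverse_on_mult(1)[OF Qinv])
  have d_normal: "subvec (transpose A *v (y - A *v d)) (T \<union> S) = 0"
    using is_inverse_on_mult(3)[OF Qinv, of "transpose A *v y"] d_supp
    by (simp add: d_def[symmetric] Q_mult matrix_vector_mult_diff_distrib subvec_diff)
  have pyth: "(norm (y - A *v b))\<^sup>2 = (norm (y - A *v d))\<^sup>2 + (norm (A *v (b - d)))\<^sup>2"
    if "subvec b (T \<union> S) = b" for b
  proof -
    have "(A *v (b - d)) \<bullet> (y - A *v d)
        = subvec (b - d) (T \<union> S) \<bullet> (transpose A *v (y - A *v d))"
      by (simp add: inner_matrix_mult subvec_diff that d_supp)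
    also have "\<dots> = 0" by (simp add: inner_subvec d_normal)
    finally have "(y - A *v d) \<bullet> (A *v (b - d)) = 0" by (simp only: inner_commute)
    moreover have split: "y - A *v b = (y - A *v d) - A *v (b - d)"
      by (simp add: matrix_vector_mult_diff_distrib)
    ultimately show ?thesis
      unfolding split using dot_norm_neg[of "y - A *v d" "A *v (b - d)"] by simp
  qed
  have "c A y T S = d"
    unfolding c_def
  proof (rule the_equality)
    show "is_arg_min (\<lambda>b. 1/2 * (norm (y - A *v b))\<^sup>2) (\<lambda>b. subvec b (- (T \<union> S)) = 0) d"
      unfolding is_arg_min_def subvec_compl_eq_0_iff
    proof (intro conjI notI)
      assume "\<exists>b. subvec b (T \<union> S) = b
          \<and> 1/2 * (norm (y - A *v b))\<^sup>2 < 1/2 * (norm (y - A *v d))\<^sup>2"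
      then obtain b where "subvec b (T \<union> S) = b"
        and less: "(norm (y - A *v b))\<^sup>2 < (norm (y - A *v d))\<^sup>2" by auto
      then have "(norm (y - A *v d))\<^sup>2 \<le> (norm (y - A *v b))\<^sup>2" by (simp only: pyth[of b]) simp
      then show False using less by linarith
    qed (rule d_supp)
  next
    fix b
    assume b: "is_arg_min (\<lambda>b. 1/2 * (norm (y - A *v b))\<^sup>2) (\<lambda>b. subvec b (- (T \<union> S)) = 0) b"
    then have b_supp: "subvec b (T \<union> S) = b"
      by (simp only: is_arg_min_def subvec_compl_eq_0_iff)
    have "\<not> (norm (y - A *v d))\<^sup>2 < (norm (y - A *v b))\<^sup>2"
      using b d_supp by (simp only: is_arg_min_def subvec_compl_eq_0_iff) auto
    then have "(norm (A *v (b - d)))\<^sup>2 \<le> 0" using pyth[OF b_supp] by simp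
    then have "A *v (b - d) = 0" by simp
    moreover have "subvec (b - d) (T \<union> S) = b - d" by (simp add: subvec_diff b_supp d_supp)
    ultimately show "b = d" using columns_inj[of "b - d"] by simp
  qed
  then show "c A y T S = Qinv A T S *v (transpose A *v y)"
    "subvec (c A y T S) (T \<union> S) = c A y T S"
    "subvec (transpose A *v (y - A *v c A y T S)) (T \<union> S) = 0"
    using d_supp d_normal by (simp_all add: d_def)
qed


text \<open>Least squares reproduces the part of \<open>x\<close> on \<open>T \<union> S\<close>
  exactly, so the error stems from \<open>w\<close> and the missed entries \<open>?v\<close>. These
  and \<open>?K *v ?v\<close> have disjoint supports, whence the summand 1 in
  \<open>f4\<close>.\<close>

lemma c_error:
  assumes "S \<subseteq> \<Delta>" "supp x \<subseteq> T \<union> \<Delta>" "T \<inter> \<Delta> = {}" and y: "y = A *v x + w"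
  shows "norm (x - c A y T S) \<le> f3 A T S * norm w + f4 A T \<Delta> S * norm (subvec x (\<Delta> - S))"
proof -
  let ?U = "T \<union> S" and ?v = "subvec x (\<Delta> - S)"
  let ?F = "Qinv A T S ** transpose (cols A ?U)"
  let ?K = "?F ** cols A (\<Delta> - S)"
  have F: "?F *v r = Qinv A T S *v (transpose A *v r)" for r
    using is_inverse_on_mult(2)[OF Qinv]
    by (simp add: matrix_vector_mul_assoc[symmetric] transpose_cols_mult)
  have K: "?K *v ?v = ?F *v (A *v ?v)"
    by (simp only: matrix_vector_mul_assoc[symmetric] cols_mult) simp
  have x: "x = subvec x ?U + ?v"
    using assms(1-3) by (auto simp: vec_eq_iff supp_def)
  have "?F *v (A *v subvec x ?U) = subvec x ?U"
    unfolding F by (rule Qinv_normal_equations) simp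
  moreover have "c A y T S = ?F *v (A *v subvec x ?U + A *v ?v + w)"
    unfolding F c_eq y by (subst x) (simp add: matrix_vector_right_distrib)
  ultimately have "c A y T S = subvec x ?U + ?K *v ?v + ?F *v w"
    by (simp only: matrix_vector_right_distrib K)
  then have "x - c A y T S = - (?F *v w) + (?v - ?K *v ?v)"
    by (subst x) simp
  then have "norm (x - c A y T S) \<le> norm (?F *v w) + norm (?v - ?K *v ?v)"
    by (metis norm_minus_cancel norm_triangle_ineq)
  moreover have "norm (?v - ?K *v ?v) \<le> f4 A T \<Delta> S * norm ?v"
  proof (rule power2_le_imp_le)
    have "(norm (?v + - (?K *v ?v)))\<^sup>2 = (norm ?v)\<^sup>2 + (norm (- (?K *v ?v)))\<^sup>2"
    proof (rule norm_add_disjoint)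
      show "subvec ?v (\<Delta> - S) = ?v" by simp
      show "subvec (- (?K *v ?v)) ?U = - (?K *v ?v)"
        using is_inverse_on_mult(1)[OF Qinv, of "transpose A *v (A *v ?v)"]
        by (simp add: K F subvec_id_iff)
      show "(\<Delta> - S) \<inter> ?U = {}" using assms(3) by auto
    qed
    also have "\<dots> \<le> (norm ?v)\<^sup>2 + (opnorm ?K * norm ?v)\<^sup>2"
      using power_mono[OF opnorm_bound[of ?K ?v], of 2] by simp
    also have "\<dots> = (f4 A T \<Delta> S * norm ?v)\<^sup>2"
      by (simp add: f4_def power_mult_distrib algebra_simps)
    finally show "(norm (?v - ?K *v ?v))\<^sup>2 \<le> (f4 A T \<Delta> S * norm ?v)\<^sup>2" by simp
    show "0 \<le> f4 A T \<Delta> S * norm ?v" by (simp add: f4_def)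
  qed
  ultimately show ?thesis
    using opnorm_bound[of ?F w] by (simp add: f3_def)
qed

text \<open>The residual is \<open>w\<close> plus the image of the error, which is supported on
  \<open>T \<union> \<Delta>\<close>. So Cauchy-Schwarz involves only those columns and yields
  \<open>maxcor\<close>.\<close>

lemma residual_correlation:
  assumes "S \<subseteq> \<Delta>" "supp x \<subseteq> T \<union> \<Delta>" and y: "y = A *v x + w"
  shows "infnorm (transpose (cols A (- (T \<union> S))) *v (y - A *v c A y T S))
    \<le> infnorm (transpose (cols A (- (T \<union> S))) *v w) + maxcor A T \<Delta> S * norm (x - c A y T S)"
proof -
  let ?d = "x - c A y T S" and ?U' = "- (T \<union> S)"
  have "y - A *v c A y T S = w + A *v ?d"
    by (simp add: y matrix_vector_mult_diff_distrib)
  then have "infnorm (transpose (cols A ?U') *v (y - A *v c A y T S))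
    \<le> infnorm (transpose (cols A ?U') *v w) + infnorm (transpose (cols A ?U') *v (A *v ?d))"
    by (simp add: matrix_vector_right_distrib infnorm_triangle)
  moreover have "infnorm (transpose (cols A ?U') *v (A *v ?d)) \<le> maxcor A T \<Delta> S * norm ?d"
  proof (rule infnorm_leI)
    fix i
    show "\<bar>(transpose (cols A ?U') *v (A *v ?d)) $ i\<bar> \<le> maxcor A T \<Delta> S * norm ?d"
    proof (cases "i \<in> ?U'")
      case True
      have d: "subvec ?d (T \<union> \<Delta>) = ?d"
        unfolding subvec_id_iff
      proof (intro allI impI)
        fix j assume j: "j \<notin> T \<union> \<Delta>"
        then have "x $ j = 0" using assms(2) by (auto simp: supp_def)
        moreover have "c A y T S $ j = 0"
          using j assms(1) c_supp[of y, unfolded subvec_id_iff, rule_format, of j] by blast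
        ultimately show "?d $ j = 0" by simp
      qed
      have "(transpose (cols A ?U') *v (A *v ?d)) $ i = (A *v ?d) \<bullet> column i A"
        using True by (simp add: transpose_cols_mult transpose_mult_nth inner_commute)
      also have "\<dots> = subvec ?d (T \<union> \<Delta>) \<bullet> (transpose A *v column i A)"
        by (simp add: d inner_matrix_mult)
      also have "\<dots> = ?d \<bullet> (transpose (cols A (T \<union> \<Delta>)) *v column i A)"
        by (simp only: inner_subvec transpose_cols_mult)
      finally have "\<bar>(transpose (cols A ?U') *v (A *v ?d)) $ i\<bar>
          \<le> norm ?d * norm (transpose (cols A (T \<union> \<Delta>)) *v column i A)"
        by (simp only: Cauchy_Schwarz_ineq2)
      also have "\<dots> \<le> norm ?d * maxcor A T \<Delta> S"
        using True by (intro mult_left_mono) (auto simp: maxcor_def max0_def intro!: Max_ge)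
      finally show ?thesis by (simp add: mult.commute)
    next
      case False
      have "(transpose (cols A ?U') *v (A *v ?d)) $ i = 0"
        using False by (simp only: transpose_cols_mult subvec_nth if_False)
      then show ?thesis by (simp add: maxcor_nonneg)
    qed
  qed
  ultimately show ?thesis by linarith
qed

section \<open>Minimization over vectors supported on \<open>T \<union> S\<close>\<close>

text \<open>An objective value at most that at 0 bounds \<open>A *v b\<close>, hence
  \<open>b\<close> through the left inverse of \<open>A\<close>. So the minimum is attained on a
  compact sublevel set.\<close>

lemma restricted_minimizer:
  assumes "0 \<le> \<gamma>"
  obtains b where "subvec b (T \<union> S) = b"
    and "\<And>b'. subvec b' (T \<union> S) = b' \<Longrightarrow> modBPDN A y \<gamma> T b \<le> modBPDN A y \<gamma> T b'"
proof -
  let ?L = "modBPDN A y \<gamma> T"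
  let ?K = "{b. subvec b (T \<union> S) = b} \<inter> {b. ?L b \<le> ?L 0}"
  let ?C = "opnorm (Qinv A T S ** transpose A)"
  have "norm b \<le> ?C * (2 * norm y)" if "b \<in> ?K" for b
  proof -
    have "1/2 * (norm (y - A *v b))\<^sup>2 \<le> ?L b"
      using assms by (simp add: modBPDN_def l1norm_nonneg)
    also have "\<dots> \<le> 1/2 * (norm y)\<^sup>2" using that by (simp add: modBPDN_def)
    finally have "norm (y - A *v b) \<le> norm y" by simp
    then have "norm (A *v b) \<le> 2 * norm y"
      using norm_triangle_ineq2[of "A *v b" y] by (simp add: norm_minus_commute)
    moreover have "b = (Qinv A T S ** transpose A) *v (A *v b)"
      using that Qinv_normal_equations[of b] by (simp add: matrix_vector_mul_assoc[symmetric])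
    then have "norm b \<le> ?C * norm (A *v b)" by (metis opnorm_bound)
    ultimately show ?thesis
      using mult_left_mono[OF _ opnorm_nonneg] by (meson order_trans)
  qed
  then have "bounded ?K" by (auto simp: bounded_iff)
  moreover have "closed ?K"
    by (intro closed_Int closed_Collect_eq closed_Collect_le continuous_on_modBPDN
        linear_continuous_on linear_subvec[unfolded linear_conv_bounded_linear]
        continuous_on_const continuous_on_id)
  ultimately have "compact ?K" by (simp add: compact_eq_bounded_closed)
  moreover have "0 \<in> ?K" by simp
  ultimately obtain b where b: "b \<in> ?K" "\<And>b'. b' \<in> ?K \<Longrightarrow> ?L b \<le> ?L b'"
    using continuous_attains_inf[of ?K ?L] continuous_on_modBPDN by blast
  have "?L b \<le> ?L b'" if "subvec b' (T \<union> S) = b'" for b'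
  proof (cases "?L b' \<le> ?L 0")
    case True
    then show ?thesis using b(2) that by simp
  next
    case False
    then show ?thesis using b(1) by simp
  qed
  then show ?thesis using that b(1) by blast
qed

text \<open>The directions \<open>axis i 1\<close> and \<open>axis i (-1)\<close> give the
  coordinate conditions; the direction \<open>- b\<close> gives the summed subgradient
  condition.\<close>

lemma restricted_first_order:
  assumes "0 \<le> \<gamma>" and b: "subvec b (T \<union> S) = b"
    and min: "\<forall>b'. subvec b' (T \<union> S) = b' \<longrightarrow> modBPDN A y \<gamma> T b \<le> modBPDN A y \<gamma> T b'"
  defines "q \<equiv> transpose A *v (y - A *v b)"
  shows "i \<in> T \<Longrightarrow> q $ i = 0" and "i \<in> S \<Longrightarrow> \<bar>q $ i\<bar> \<le> \<gamma>"
    and "\<gamma> * l1norm (subvec b (- T)) \<le> b \<bullet> q"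
proof -
  have dir: "h \<bullet> q \<le> \<gamma> * D"
    if h: "subvec h (T \<union> S) = h"
      and l1: "\<And>t. 0 < t \<Longrightarrow> t < 1 \<Longrightarrow>
        l1norm (subvec (b + t *\<^sub>R h) (- T)) \<le> l1norm (subvec b (- T)) + t * D"
    for h D
    unfolding q_def
    using b h \<open>0 \<le> \<gamma>\<close>
    by (intro directional_derivative_bound[where T = T] min[rule_format] mult_left_mono l1)
      (auto simp: subvec_add subvec_scaleR)
  have coord: "r * q $ i \<le> \<gamma> * l1norm (subvec (axis i r) (- T))" if "i \<in> T \<union> S" for i r
  proof -
    have "axis i r \<bullet> q \<le> \<gamma> * l1norm (subvec (axis i r) (- T))"
    proof (rule dir)
      show "subvec (axis i r) (T \<union> S) = axis i r" using that by (simp add: subvec_axis)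
      fix t :: real assume "0 < t"
      then show "l1norm (subvec (b + t *\<^sub>R axis i r) (- T))
          \<le> l1norm (subvec b (- T)) + t * l1norm (subvec (axis i r) (- T))"
        using l1norm_triangle[of "subvec b (- T)" "t *\<^sub>R subvec (axis i r) (- T)"]
        by (simp add: subvec_add subvec_scaleR l1norm_scaleR)
    qed
    then show ?thesis by (simp add: inner_axis')
  qed
  show "q $ i = 0" if "i \<in> T"
    using coord[of i 1] coord[of i "-1"] that by (simp add: subvec_axis)
  show "\<bar>q $ i\<bar> \<le> \<gamma>" if "i \<in> S"
  proof -
    have "i \<notin> T" using that disjoint by auto
    then show ?thesis
      using coord[of i 1] coord[of i "-1"] that by (simp add: subvec_axis l1norm_axis)
  qed
  have "(- b) \<bullet> q \<le> \<gamma> * (- l1norm (subvec b (- T)))"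
  proof (rule dir)
    show "subvec (- b) (T \<union> S) = - b" using b by (simp add: subvec_id_iff)
    fix t :: real assume "t < 1"
    \<comment> \<open>Shrinking towards 0 scales the l1 norm by \<open>1 - t\<close>, so the slope
      is exact.\<close>
    moreover have "b + t *\<^sub>R (- b) = (1 - t) *\<^sub>R b" by (simp add: algebra_simps)
    ultimately show "l1norm (subvec (b + t *\<^sub>R (- b)) (- T))
        \<le> l1norm (subvec b (- T)) + t * (- l1norm (subvec b (- T)))"
      by (simp only: subvec_scaleR l1norm_scaleR) (simp add: algebra_simps)
  qed
  then show "\<gamma> * l1norm (subvec b (- T)) \<le> b \<bullet> q" by simp
qed


section \<open>Global optimality, uniqueness and the error bound\<close>

text \<open>If another minimizer $b'$ had a nonzero entry outside $T \cup S$, then the residual of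
  the least-squares solution would correlate strictly positively with $A b'$; but $A b'$ equals
  $A b$ with $b$ supported on $T \cup S$, where that residual has no correlation.\<close>

theorem modBPDN_recovery:
  assumes "S \<subseteq> \<Delta>" "supp x \<subseteq> T \<union> \<Delta>" "T \<inter> \<Delta> = {}" and y: "y = A *v x + w"
    and gamma: "gamma_star A y T S = Some \<gamma>"
  shows "\<exists>b. minimizer (modBPDN A y \<gamma> T) b \<and>
      (\<gamma> \<noteq> 0 \<longrightarrow> (\<forall>b'. minimizer (modBPDN A y \<gamma> T) b' \<longrightarrow> b' = b)) \<and>
      supp b \<subseteq> T \<union> S \<and> norm (x - b) \<le> g A x w T \<Delta> S"
proof -
  define c0 where "c0 = c A y T S"
  define \<rho> where "\<rho> = transpose A *v (y - A *v c0)"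
  let ?\<rho>' = "transpose (cols A (- (T \<union> S))) *v (y - A *v c0)"
  have ERC: "0 < ERC A T S" and \<gamma>_eq: "\<gamma> * ERC A T S = infnorm ?\<rho>'"
    using gamma by (auto simp: gamma_star_def c0_def split: if_splits)
  then have \<gamma>: "0 \<le> \<gamma>"
    using infnorm_pos_le[of ?\<rho>'] by (metis zero_le_mult_iff not_less order_less_imp_le)
  obtain b where b: "subvec b (T \<union> S) = b"
    and min: "\<forall>b'. subvec b' (T \<union> S) = b' \<longrightarrow> modBPDN A y \<gamma> T b \<le> modBPDN A y \<gamma> T b'"
    using restricted_minimizer[OF \<gamma>, of y] by blast
  define q where "q = transpose A *v (y - A *v b)"
  note first_order = restricted_first_order[OF \<gamma> b min, folded q_def]
  \<comment> \<open>For \<open>\<gamma> = 0\<close> division by zero gives \<open>s = 0\<close>, in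
    accord with the first-order conditions, by which \<open>q\<close> then vanishes on
    \<open>T \<union> S\<close>.\<close>
  define s where "s = (1 / \<gamma>) *\<^sub>R subvec q (T \<union> S)"
  have s_le: "\<bar>s $ i\<bar> \<le> 1" for i
    using first_order(1,2)[of i] \<gamma> by (auto simp: s_def abs_mult divide_le_eq_1)
  have s: "\<gamma> *\<^sub>R s = subvec q (T \<union> S)" "subvec s S = s"
    using first_order(1,2) by (auto simp: s_def vec_eq_iff)
  \<comment> \<open>Both sides solve the same normal equations: \<open>\<rho>\<close> vanishes on
    \<open>T \<union> S\<close>, so both right-hand sides are \<open>q\<close> restricted to that
    set.\<close>
  have diff: "c0 - b = \<gamma> *\<^sub>R lift s"
  proof (rule normal_equations_inj)
    show "subvec (c0 - b) (T \<union> S) = c0 - b" by (simp add: subvec_diff b c_supp c0_def)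
    show "subvec (\<gamma> *\<^sub>R lift s) (T \<union> S) = \<gamma> *\<^sub>R lift s" by (simp add: subvec_scaleR lift_supp)
    have "transpose A *v (A *v (c0 - b)) = q - \<rho>"
      by (simp add: q_def \<rho>_def matrix_vector_mult_diff_distrib)
    then show "subvec (transpose A *v (A *v (c0 - b))) (T \<union> S)
        = subvec (transpose A *v (A *v (\<gamma> *\<^sub>R lift s))) (T \<union> S)"
      using s by (simp add: subvec_diff \<rho>_def c0_def c_normal matrix_vector_mult_scaleR
          subvec_scaleR lift_normal)
  qed
  define e where "e i = column i A \<bullet> (A *v lift s)" for i
  have q_split: "q $ i = \<rho> $ i + \<gamma> * e i" for i
  proof -
    have "q = \<rho> + transpose A *v (A *v (c0 - b))"
      by (simp add: q_def \<rho>_def matrix_vector_mult_diff_distrib)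
    then show ?thesis
      by (simp add: diff matrix_vector_mult_scaleR transpose_mult_nth e_def)
  qed
  have e: "\<bar>e i\<bar> \<le> 1 - ERC A T S" if "i \<notin> T \<union> S" for i
    unfolding e_def using lift_correlation[OF s_le that] .
  have \<rho>: "\<bar>\<rho> $ i\<bar> \<le> \<gamma> * ERC A T S" if "i \<notin> T \<union> S" for i
    using component_le_infnorm_cart[of ?\<rho>' i] that
    by (simp add: \<gamma>_eq transpose_cols_mult \<rho>_def)
  have q_le: "\<bar>q $ i\<bar> \<le> \<gamma>" for i
  proof (cases "i \<in> T \<union> S")
    case True
    then show ?thesis using first_order(1,2) \<gamma> by auto
  next
    case False
    have "\<bar>q $ i\<bar> \<le> \<bar>\<rho> $ i\<bar> + \<gamma> * \<bar>e i\<bar>"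
      using \<gamma> abs_triangle_ineq[of "\<rho> $ i" "\<gamma> * e i"] by (simp add: q_split abs_mult)
    also have "\<dots> \<le> \<gamma> * ERC A T S + \<gamma> * (1 - ERC A T S)"
      using \<rho>[OF False] e[OF False] \<gamma> by (intro add_mono mult_left_mono) auto
    finally show ?thesis by (simp add: algebra_simps)
  qed
  have q_T: "\<forall>i\<in>T. q $ i = 0" and q_all: "\<forall>i. \<bar>q $ i\<bar> \<le> \<gamma>"
    using first_order(1) q_le by auto
  note optimal = modBPDN_minimizer[of A y b \<gamma> T, folded q_def, OF q_all q_T first_order(3)]
  have unique: "b' = b" if "\<gamma> \<noteq> 0" and b': "minimizer (modBPDN A y \<gamma> T) b'" for b'
  proof -
    \<comment> \<open>The inner product with \<open>\<rho>\<close> depends only on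
      \<open>A *v b'\<close>, which all minimizers share.\<close>
    have "b' \<bullet> \<rho> = b \<bullet> \<rho>"
      using optimal(2)[OF b'] by (simp add: \<rho>_def inner_matrix_mult[symmetric])
    also have "\<dots> = b \<bullet> subvec \<rho> (T \<union> S)" using b by (metis inner_subvec)
    finally have orth: "b' \<bullet> \<rho> = 0" by (simp add: \<rho>_def c0_def c_normal)
    have \<rho>0: "\<rho> $ i = 0" if "i \<in> T \<union> S" for i
      using c_normal[of y] that by (auto simp: \<rho>_def c0_def vec_eq_iff split: if_splits)
    \<comment> \<open>In the subgradient equality for \<open>b'\<close>, the part
      \<open>\<gamma> * e i\<close> of \<open>q\<close> accounts for at most the share
      \<open>1 - ERC A T S\<close>; the rest must come from \<open>\<rho>\<close>.\<close>
    have lower: "\<gamma> * ERC A T S * \<bar>b' $ i\<bar> \<le> b' $ i * \<rho> $ i" if "i \<notin> T \<union> S" for i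
    proof -
      have "b' $ i * (\<rho> $ i + \<gamma> * e i) = \<gamma> * \<bar>b' $ i\<bar>"
        using optimal(3)[OF b', of i] that by (simp add: q_split)
      moreover have "b' $ i * e i \<le> \<bar>b' $ i\<bar> * (1 - ERC A T S)"
        using mult_left_mono[OF e[OF that], of "\<bar>b' $ i\<bar>"]
        by (metis abs_ge_self abs_ge_zero abs_mult order_trans)
      then have "\<gamma> * (b' $ i * e i) \<le> \<gamma> * (\<bar>b' $ i\<bar> * (1 - ERC A T S))"
        using \<gamma> by (rule mult_left_mono)
      ultimately show ?thesis by (simp add: algebra_simps)
    qed
    have nonneg: "0 \<le> b' $ i * \<rho> $ i" for i
      using lower[of i] \<rho>0[of i] \<gamma> ERC
      by (cases "i \<in> T \<union> S") (auto intro: order_trans[rotated])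
    have "b' $ i = 0" if "i \<notin> T \<union> S" for i
    proof -
      have "b' $ i * \<rho> $ i = 0"
        using orth nonneg by (simp add: inner_vec_def sum_nonneg_eq_0_iff)
      then have "\<gamma> * ERC A T S * \<bar>b' $ i\<bar> \<le> 0" using lower[OF that] by linarith
      \<comment> \<open>Here \<open>\<gamma> \<noteq> 0\<close> enters: with a zero factor the bound
        would say nothing about \<open>b' $ i\<close>.\<close>
      moreover have "0 < \<gamma> * ERC A T S" using \<gamma> ERC \<open>\<gamma> \<noteq> 0\<close> by simp
      ultimately show ?thesis by (metis abs_le_zero_iff mult_le_0_iff not_less)
    qed
    then have "subvec (b' - b) (T \<union> S) = b' - b"
      using b by (simp add: subvec_id_iff)
    moreover have "A *v (b' - b) = 0"
      using optimal(2)[OF b'] by (simp add: matrix_vector_mult_diff_distrib)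
    ultimately show ?thesis using columns_inj[of "b' - b"] by simp
  qed
  have "norm (x - b) \<le> g A x w T \<Delta> S"
  proof -
    define E where "E = f3 A T S * norm w + f4 A T \<Delta> S * norm (subvec x (\<Delta> - S))"
    define R where "R = infnorm (transpose (cols A (- (T \<union> S))) *v w)"
    have E: "norm (x - c0) \<le> E"
      unfolding E_def c0_def by (rule c_error[OF assms(1-4)])
    have f1: "0 \<le> f1 A T S" by (simp add: f1_def)
    have "\<gamma> * ERC A T S \<le> R + maxcor A T \<Delta> S * norm (x - c0)"
      unfolding \<gamma>_eq R_def c0_def by (rule residual_correlation[OF assms(1,2,4)])
    also have "\<dots> \<le> R + maxcor A T \<Delta> S * E" using E by (simp add: mult_left_mono maxcor_nonneg)
    finally have \<gamma>_le: "\<gamma> \<le> (R + maxcor A T \<Delta> S * E) / ERC A T S"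
      using ERC by (simp add: pos_le_divide_eq)
    \<comment> \<open>The entries of \<open>s\<close> are at most 1 in size and live on
      \<open>S\<close>, which gives the factor \<open>sqrt (card S)\<close>.\<close>
    have "norm s \<le> sqrt (card S)"
    proof -
      have "(norm s)\<^sup>2 = (\<Sum>i\<in>UNIV. (s $ i)\<^sup>2)"
        unfolding power2_norm_eq_inner inner_vec_def by (simp add: power2_eq_square)
      also have "\<dots> \<le> (\<Sum>i\<in>UNIV. if i \<in> S then 1 else 0)"
      proof (rule sum_mono)
        fix i
        show "(s $ i)\<^sup>2 \<le> (if i \<in> S then 1 else 0)"
          using s(2) s_le[of i] by (auto simp: subvec_id_iff abs_square_le_1)
      qed
      also have "\<dots> = card S" by (simp add: sum.If_cases)
      finally show ?thesis by (simp add: real_le_rsqrt)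
    qed
    then have "norm (lift s) \<le> f1 A T S * sqrt (card S)"
      using lift_norm[of s] f1 by (meson mult_left_mono order_trans)
    then have "norm (c0 - b) \<le> \<gamma> * (f1 A T S * sqrt (card S))"
      using \<gamma> by (simp add: diff mult_left_mono)
    also have "\<dots> \<le> (R + maxcor A T \<Delta> S * E) / ERC A T S * (f1 A T S * sqrt (card S))"
      using \<gamma>_le f1 by (intro mult_right_mono) auto
    finally have "norm (c0 - b) \<le> \<dots>" .
    moreover have "norm (x - b) \<le> norm (x - c0) + norm (c0 - b)"
      using norm_triangle_ineq[of "x - c0" "c0 - b"] by simp
    \<comment> \<open>Collecting the coefficients of \<open>norm w\<close>, of the norm of the
      missed entries and of \<open>R\<close> recovers \<open>g2\<close>, \<open>g3\<close> and
      \<open>g4\<close>.\<close>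
    moreover have "g A x w T \<Delta> S
        = E + (R + maxcor A T \<Delta> S * E) / ERC A T S * (f1 A T S * sqrt (card S))"
      by (simp add: g_def g2_def g3_def g4_def E_def R_def add_divide_distrib algebra_simps)
    ultimately show ?thesis using E by linarith
  qed
  moreover have "supp b \<subseteq> T \<union> S" using b by (auto simp: subvec_id_iff supp_def)
  ultimately show ?thesis using optimal(1) unique by blast
qed

end

section \<open>Specialization to mod-BPDN and BPDN\<close>

lemma optimal_subset_le: "optimal_subset A x w T \<Delta> S \<Longrightarrow> S \<subseteq> \<Delta>"
  by (auto simp: optimal_subset_def best_of_size_def is_arg_min_def)

text \<open>Makes part (b) the case \<open>T = {}\<close> of part (a).\<close>

lemma modBPDN_empty: "modBPDN A y \<gamma> {} = BPDN A y \<gamma>"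
  by (simp add: fun_eq_iff modBPDN_def BPDN_def)

text \<open>If \<open>S\<close> is not in \<open>G\<close>, then \<open>gamma_star\<close> is
  \<open>None\<close> and nothing is claimed. Uniqueness is guarded by
  \<open>\<gamma> \<noteq> 0\<close>: the value 0 can occur (\<open>gamma_star_eq_0\<close>), and
  there uniqueness fails (\<open>minimizer_not_unique_at_0\<close>).\<close>

theorem corollary4:
  fixes A :: "real^'m^'n" and x :: "real^'m" and w y :: "real^'n"
    and T :: "'m set" and \<gamma> :: real
  assumes "CARD('n) < CARD('m)"
    and "y = A *v x + w"
  shows
    "(\<forall>S. optimal_subset A x w T (supp x - T) S \<and> gamma_star A y T S = Some \<gamma> \<longrightarrow>
        (\<exists>xhat. minimizer (modBPDN A y \<gamma> T) xhat \<and>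
           (\<gamma> \<noteq> 0 \<longrightarrow> (\<forall>b. minimizer (modBPDN A y \<gamma> T) b \<longrightarrow> b = xhat)) \<and>
           supp xhat \<subseteq> T \<union> S \<and>
           norm (x - xhat) \<le> g A x w T (supp x - T) S))
     \<and>
     (\<forall>S. optimal_subset A x w {} (supp x) S \<and> gamma_star A y {} S = Some \<gamma> \<longrightarrow>
        (\<exists>xhat. minimizer (BPDN A y \<gamma>) xhat \<and>
           (\<gamma> \<noteq> 0 \<longrightarrow> (\<forall>b. minimizer (BPDN A y \<gamma>) b \<longrightarrow> b = xhat)) \<and>
           supp xhat \<subseteq> S \<and>
           norm (x - xhat) \<le> g A x w {} (supp x) S))"
proof -
  have recovery: "\<exists>b. minimizer (modBPDN A y \<gamma> T) b \<and>
      (\<gamma> \<noteq> 0 \<longrightarrow> (\<forall>b'. minimizer (modBPDN A y \<gamma> T) b' \<longrightarrow> b' = b)) \<and>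
      supp b \<subseteq> T \<union> S \<and> norm (x - b) \<le> g A x w T (supp x - T) S"
    if "optimal_subset A x w T (supp x - T) S" and gamma: "gamma_star A y T S = Some \<gamma>"
    for T S
  proof -
    have S: "S \<subseteq> supp x - T" using that(1) by (rule optimal_subset_le)
    \<comment> \<open>That \<open>gamma_star\<close> is defined supplies invertibility;
      \<open>S\<close> avoids \<open>T\<close> as a subset of \<open>supp x - T\<close>.\<close>
    interpret independent_columns A T S
      using S gamma by unfold_locales (auto simp: gamma_star_def split: if_splits)
    show ?thesis using S assms(2) gamma by (intro modBPDN_recovery) auto
  qed
  show ?thesis
    using recovery[of T] recovery[of "{}"] by (simp add: modBPDN_empty)
qed

end
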